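(* Let $n\ge 0$ and $d_1,\dots,d_n\in\{0,1\}$. For $0\le i\le n$ let $D_i=\operatorname{diag}(d_1,\dots,d_i)$ over $\mathbb F_2$, $s_i=\sum_{j=1}^i d_j$ (computed as an integer), $z_i=i-s_i$, and let $h_i(t)$ be the number of $i\times i$ upper triangular matrices $U$ over $\mathbb F_2$ with $U^TU=D_i$ and $\operatorname{rank}U=s_i+t$. For every $0\le i\le n$, $h_i(t)=0$ unless $0\le t\le\lfloor z_i/2\rfloor$. For $1\le i\le n$ the following recurrences hold. If $d_i=1$, then for $0\le t\le\lfloor z_i/2\rfloor$, $$h_i(t)=2^{z_i-t}\,h_{i-1}(t).$$ If $d_i=0$, then $h_i(0)=h_{i-1}(0)$ and, for $1\le t\le\lfloor z_i/2\rfloor$, $$h_i(t)=2^t\,h_{i-1}(t)+\bigl(2^{z_i-t}-2^{t-1}\bigr)h_{i-1}(t-1).$$ Finally, $$\nu(D_n)=\sum_{t=0}^{\lfloor z_n/2\rfloor}h_n(t).$$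
   Context: For a symmetric $k\times k$ matrix $M$ over $\mathbb F_2$, $\nu(M)$ denotes the number of $k\times k$ upper triangular matrices $U$ over $\mathbb F_2$ (not necessarily invertible) with $U^TU=M$. Here $t$ ranges over integers, and the convention for $i=0$ (empty matrix) is $h_0(0)=1$ and $h_0(t)=0$ for $t\ne 0$; also $\nu$ of the empty $0\times 0$ matrix is $1$. *)

theory Defs
  imports "Jordan_Normal_Form.DL_Rank" "HOL-Library.Z2"
begin

text \<open>The field with two elements is the type \<^typ>\<open>bit\<close>.
  The intended use of \<open>factorization_count\<close> is for symmetric square matrices.\<close>

definition factorization_count :: "bit mat \<Rightarrow> nat" (\<open>\<nu>\<close>) where
  "\<nu> M = card {U \<in> carrier_mat (dim_row M) (dim_row M).
              upper_triangular U \<and> transpose_mat U * U = M}"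

text \<open>The sequence \<open>d\<close> is indexed from 1, whereas matrix entries are indexed from 0;
  so entry \<open>(k, k)\<close> of the matrix below is \<open>d (k + 1)\<close>. Values \<open>d 0\<close> and
  \<open>d j\<close> for \<open>j > i\<close> play no role.\<close>

definition diag_prefix :: "(nat \<Rightarrow> nat) \<Rightarrow> nat \<Rightarrow> bit mat" where
  "diag_prefix d i = mat_diag i (\<lambda>k. of_nat (d (Suc k)))"

definition ones :: "(nat \<Rightarrow> nat) \<Rightarrow> nat \<Rightarrow> nat" where
  "ones d i = (\<Sum>j = 1..i. d j)"

definition zeros :: "(nat \<Rightarrow> nat) \<Rightarrow> nat \<Rightarrow> int" where
  "zeros d i = int i - int (ones d i)"

text \<open>The argument \<open>t\<close> is an arbitrary integer. For \<open>i = 0\<close> there is exactly one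
  (empty) matrix, of rank 0, which yields the values 1 at \<open>t = 0\<close> and 0 elsewhere.\<close>

definition rank_count :: "(nat \<Rightarrow> nat) \<Rightarrow> nat \<Rightarrow> int \<Rightarrow> nat" where
  "rank_count d i t = card {U \<in> carrier_mat i i.
     upper_triangular U \<and> transpose_mat U * U = diag_prefix d i \<and>
     int (vec_space.rank i U) = int (ones d i) + t}"

lemma carrier_mat_0_0: "(U :: bit mat) \<in> carrier_mat 0 0 \<longleftrightarrow> U = 1\<^sub>m 0"
  by (auto intro: eq_matI)

lemma factorization_count_empty: "\<nu> (1\<^sub>m 0) = 1"
proof -
  have "{U \<in> carrier_mat 0 0. upper_triangular U \<and> transpose_mat U * U = (1\<^sub>m 0 :: bit mat)} = {1\<^sub>m 0}"
    unfolding carrier_mat_0_0 by auto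
  then show ?thesis unfolding factorization_count_def by simp
qed

lemma rank_count_0: "rank_count d 0 t = (if t = 0 then 1 else 0)"
proof -
  have "vec_space.rank 0 (1\<^sub>m 0 :: bit mat) = 0"
    using vec_space.rank_le_nc[of "1\<^sub>m 0 :: bit mat" 0 0] by simp
  moreover have "diag_prefix d 0 = 1\<^sub>m 0"
    unfolding diag_prefix_def by (intro eq_matI) (auto simp: mat_diag_def)
  ultimately have "{U \<in> carrier_mat 0 0. upper_triangular U \<and> transpose_mat U * U = diag_prefix d 0 \<and>
      int (vec_space.rank 0 U) = int (ones d 0) + t} = (if t = 0 then {1\<^sub>m 0} else {})"
    unfolding carrier_mat_0_0 by (auto simp: ones_def)
  then show ?thesis unfolding rank_count_def by simp
qed

end

theory Submission
  imports Defs "Jordan_Normal_Form.Matrix_Kernel"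
begin

text \<open>Delete the last row and column of an upper triangular \<open>A\<close> of size \<open>n + 1\<close>: what remains
  is an upper triangular \<open>U\<close>, and \<open>A\<close> is \<open>U\<close> bordered by a column \<open>b\<close> with a corner
  entry \<open>c\<close> below it. The Gram matrix of \<open>A\<close> is the diagonal matrix of \<open>d\<^sub>1, \<dots>, d\<^sub>n\<^sub>+\<^sub>1\<close>
  exactly when that of \<open>U\<close> is the diagonal matrix of \<open>d\<^sub>1, \<dots>, d\<^sub>n\<close>, the column \<open>b\<close> lies in
  \<open>K = ker U\<^sup>T\<close>, and \<open>b \<bullet> b + c\<^sup>2 = d\<^sub>n\<^sub>+\<^sub>1\<close>. Over two elements the last condition
  determines \<open>c\<close>, so the extensions of \<open>U\<close> correspond to the vectors \<open>b \<in> K\<close>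
  (\<open>triangular_factors_Suc\<close>). The recurrences come from counting these \<open>b\<close> according to the
  rank of the extension, which exceeds \<open>r = rank U\<close> by one unless \<open>c = 0\<close> and \<open>b\<close> lies in
  the column space \<open>W\<close> of \<open>U\<close> (\<open>rank_border\<close>).

  Since \<open>K\<close> is the orthogonal complement of \<open>W\<close>, it has \<open>2\<^sup>n\<^sup>-\<^sup>r\<close> elements, and every
  \<open>b \<in> K \<inter> W\<close> satisfies \<open>b \<bullet> b = 0\<close>. Hence, if \<open>d\<^sub>n\<^sub>+\<^sub>1 = 1\<close>, a vector \<open>b \<in> K \<inter> W\<close>
  forces \<open>c = 1\<close> and the rank always grows; if \<open>d\<^sub>n\<^sub>+\<^sub>1 = 0\<close>, such a vector forces
  \<open>c = 0\<close> and the rank stays the same exactly for \<open>b \<in> K \<inter> W\<close>.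

  To count \<open>K \<inter> W\<close>, observe that it is the image under \<open>U\<close> of the kernel of
  \<open>U\<^sup>T U = diag(d\<^sub>1, \<dots>, d\<^sub>n)\<close>. That kernel has dimension \<open>n - s\<close>, where \<open>s\<close> is the number of
  ones, and it contains \<open>ker U\<close>, of dimension \<open>n - r\<close>. So \<open>K \<inter> W\<close> has dimension \<open>t = r - s\<close>;
  this is also where \<open>t \<ge> 0\<close> comes from, and \<open>K \<inter> W \<subseteq> K\<close> gives \<open>t \<le> n - r\<close>, which says that
  \<open>t\<close> is at most half the number of zeros (\<open>factor_counts\<close>).

  Dimensions are handled as cardinalities throughout: a space over the field with two elements
  is measured by its number of vectors, and the rank enters through the fact that a column
  space has \<open>2\<close> to the power of the rank elements (\<open>card_column_space\<close>). Rank-nullity is then a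
  count of fibres, and the size of an orthogonal complement is a double count of signs.\<close>

section \<open>Vectors over the field with two elements\<close>

text \<open>By default arithmetic on bits is rewritten to exclusive or and conjunction, and the dimension
  \<open>1\<close> of the last block of a bordered matrix to \<open>Suc 0\<close>. Both hide the ring structure and the
  block sizes from the lemmas on vectors and matrices.\<close>

declare add_bit_eq_xor [simp del] mult_bit_eq_and [simp del] One_nat_def [simp del]

lemma bit_UNIV: "(UNIV :: bit set) = {0, 1}"
proof (intro equalityI subsetI)
  show "x \<in> {0, 1}" for x :: bit by (cases x) simp_all
qed simp

lemma card_UNIV_bit: "finite (UNIV :: bit set)" "card (UNIV :: bit set) = 2"
  unfolding bit_UNIV by simp_all

lemma bit_add_self [simp]: "x + x = (0 :: bit)"
  by (cases x) simp_all

lemma bit_vec_add_self: "v \<in> carrier_vec n \<Longrightarrow> v + v = (0\<^sub>v n :: bit vec)"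
  by (intro eq_vecI) auto

lemma card_box_vec:
  assumes "\<And>k. k < n \<Longrightarrow> finite (A k)"
  shows "finite {x \<in> carrier_vec n. \<forall>k<n. x $ k \<in> A k}"
    and "card {x \<in> carrier_vec n. \<forall>k<n. x $ k \<in> A k} = (\<Prod>k<n. card (A k))"
proof -
  have "bij_betw (vec n) (PiE {..<n} A) {x \<in> carrier_vec n. \<forall>k<n. x $ k \<in> A k}"
  proof (rule bij_betw_byWitness[where f' = "\<lambda>x. restrict (\<lambda>k. x $ k) {..<n}"])
    show "\<forall>f\<in>PiE {..<n} A. restrict (\<lambda>k. vec n f $ k) {..<n} = f"
    proof (intro ballI ext)
      fix f k assume "f \<in> PiE {..<n} A"
      then have "f k = undefined" if "\<not> k < n" using PiE_arb[of f "{..<n}" A k] that by simp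
      then show "restrict (\<lambda>k. vec n f $ k) {..<n} k = f k"
        by (cases "k < n") simp_all
    qed
    show "\<forall>x\<in>{x \<in> carrier_vec n. \<forall>k<n. x $ k \<in> A k}. vec n (restrict (\<lambda>k. x $ k) {..<n}) = x"
      by (intro ballI eq_vecI) (auto dest: carrier_vecD)
    show "vec n ` PiE {..<n} A \<subseteq> {x \<in> carrier_vec n. \<forall>k<n. x $ k \<in> A k}"
      by (intro image_subsetI) (simp add: PiE_mem)
    show "(\<lambda>x. restrict (\<lambda>k. x $ k) {..<n}) ` {x \<in> carrier_vec n. \<forall>k<n. x $ k \<in> A k} \<subseteq> PiE {..<n} A"
      by (intro image_subsetI) simp
  qed
  note bij = this
  show "finite {x \<in> carrier_vec n. \<forall>k<n. x $ k \<in> A k}"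
    using bij_betw_finite[OF bij] finite_PiE[of "{..<n}" A] assms by auto
  show "card {x \<in> carrier_vec n. \<forall>k<n. x $ k \<in> A k} = (\<Prod>k<n. card (A k))"
    using bij_betw_same_card[OF bij] card_PiE[of "{..<n}" A] by simp
qed

lemma card_carrier_vec_bit:
  "finite (carrier_vec n :: bit vec set)" "card (carrier_vec n :: bit vec set) = 2 ^ n"
  using card_box_vec[of n "\<lambda>_. UNIV :: bit set"] by (simp_all add: card_UNIV_bit)

text \<open>Over the field with two elements, scalar multiples of \<open>x\<close> are \<open>0\<close> and \<open>x\<close>, so an additively
  closed set containing \<open>0\<close> is already a linear subspace.\<close>

definition bit_subspace :: "nat \<Rightarrow> bit vec set \<Rightarrow> bool" where
  "bit_subspace n S \<longleftrightarrow> S \<subseteq> carrier_vec n \<and> 0\<^sub>v n \<in> S \<and> (\<forall>x\<in>S. \<forall>y\<in>S. x + y \<in> S)"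

lemma bit_subspace_finite: "bit_subspace n S \<Longrightarrow> finite S"
  using card_carrier_vec_bit(1) finite_subset unfolding bit_subspace_def by blast

lemma bit_vec_add_cancel:
  assumes "x \<in> carrier_vec n" "y \<in> carrier_vec n"
  shows "x + (x + y) = (y :: bit vec)"
  using assms assoc_add_vec[of x n x y] by (simp add: bit_vec_add_self)

lemma bit_subspace_translate:
  assumes S: "bit_subspace n S" and a: "a \<in> S"
  shows "bij_betw (\<lambda>x. a + x) S S"
  by (rule bij_betw_byWitness[where f' = "\<lambda>x. a + x"])
    (use S a bit_vec_add_cancel[of _ n] in \<open>auto simp: bit_subspace_def subset_iff\<close>)

lemma translate_inj:
  assumes "S \<subseteq> carrier_vec n" "a \<in> carrier_vec n"
  shows "inj_on (\<lambda>x. a + x) (S :: bit vec set)"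
  by (rule inj_on_inverseI[where g = "\<lambda>x. a + x"])
    (use assms bit_vec_add_cancel[of _ n] in \<open>auto simp: subset_iff\<close>)

text \<open>Adjoining a vector to a subspace either changes nothing or adds one disjoint coset. This is
  what turns "the rank grows by at most one" into a statement about cardinalities.\<close>

lemma card_adjoin:
  assumes S: "bit_subspace n S" and a: "a \<in> carrier_vec n"
  shows "card (S \<union> (\<lambda>x. a + x) ` S) = (if a \<in> S then card S else 2 * card S)"
proof (cases "a \<in> S")
  case True
  then show ?thesis using S by (auto simp: bit_subspace_def subset_iff intro!: arg_cong[of _ _ card])
next
  case False
  have "S \<inter> (\<lambda>x. a + x) ` S = {}"
  proof (rule ccontr)
    assume "\<not> ?thesis"
    then obtain x where x: "x \<in> S" "a + x \<in> S" by auto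
    then have "x + (a + x) \<in> S" using S by (auto simp: bit_subspace_def)
    moreover have "x + (a + x) = a"
      using x a S bit_vec_add_cancel[of x n a] comm_add_vec[of a n x]
      by (auto simp: bit_subspace_def subset_iff)
    ultimately show False using False by simp
  qed
  moreover have "card ((\<lambda>x. a + x) ` S) = card S"
    using translate_inj[of S n a] S a by (auto simp: bit_subspace_def card_image)
  ultimately show ?thesis
    using False bit_subspace_finite[OF S] by (simp add: card_Un_disjoint)
qed

text \<open>The nonempty fibres of an additive map are cosets of its kernel; this is the rank-nullity theorem
  in terms of cardinalities, for a map restricted to a subspace.\<close>

lemma card_kernel_times_image:
  fixes f :: "bit vec \<Rightarrow> bit vec"
  assumes S: "bit_subspace n S" 
    and f: "\<And>x. x \<in> S \<Longrightarrow> f x \<in> carrier_vec m"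
    and add: "\<And>x y. x \<in> S \<Longrightarrow> y \<in> S \<Longrightarrow> f (x + y) = f x + f y"
  shows "card S = card {x \<in> S. f x = 0\<^sub>v m} * card (f ` S)"
proof -
  have fin: "finite S" using S by (rule bit_subspace_finite)
  have fiber: "card {x \<in> S. f x = f a} = card {x \<in> S. f x = 0\<^sub>v m}" if a: "a \<in> S" for a
  proof -
    have "bij_betw (\<lambda>x. a + x) {x \<in> S. f x = 0\<^sub>v m} {x \<in> S. f x = f a}"
    proof (rule bij_betw_byWitness[where f' = "\<lambda>x. a + x"])
      show "(\<lambda>x. a + x) ` {x \<in> S. f x = 0\<^sub>v m} \<subseteq> {x \<in> S. f x = f a}"
        using S a f by (auto simp: add bit_subspace_def)
      show "(\<lambda>x. a + x) ` {x \<in> S. f x = f a} \<subseteq> {x \<in> S. f x = 0\<^sub>v m}"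
        using S a f[OF a] by (auto simp: add bit_subspace_def bit_vec_add_self)
    qed (use S a bit_vec_add_cancel[of a n] in \<open>auto simp: bit_subspace_def subset_iff\<close>)
    then show ?thesis by (simp add: bij_betw_same_card)
  qed
  have "card S = (\<Sum>y\<in>f ` S. card {x \<in> S. f x = y})"
    using sum.image_gen[OF fin, of "\<lambda>_. 1::nat" f] by simp
  also have "\<dots> = (\<Sum>y\<in>f ` S. card {x \<in> S. f x = 0\<^sub>v m})"
    using fiber by (intro sum.cong) auto
  finally show ?thesis by (simp add: mult.commute)
qed

section \<open>Orthogonal complements\<close>

text \<open>The nontrivial character of the additive group of the field.\<close>

definition bit_sign :: "bit \<Rightarrow> int" where
  "bit_sign b = (if b = 0 then 1 else - 1)"

lemma bit_sign_add: "bit_sign (a + b) = bit_sign a * bit_sign b"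
  by (cases a; cases b) (simp_all add: bit_sign_def)

text \<open>Orthogonality of characters: if \<open>f a = 1\<close> for some \<open>a \<in> S\<close>, translation by \<open>a\<close> permutes \<open>S\<close> and
  flips every sign, so the sum equals its own negative.\<close>

lemma sum_bit_sign:
  assumes S: "bit_subspace n S"
    and add: "\<And>x y. x \<in> S \<Longrightarrow> y \<in> S \<Longrightarrow> f (x + y) = f x + f y"
  shows "(\<Sum>x\<in>S. bit_sign (f x)) = (if \<forall>x\<in>S. f x = 0 then int (card S) else 0)"
proof (cases "\<forall>x\<in>S. f x = 0")
  case True
  then show ?thesis by (simp add: bit_sign_def)
next
  case False
  then obtain a where a: "a \<in> S" "f a = 1" by auto
  have "(\<Sum>x\<in>S. bit_sign (f x)) = (\<Sum>x\<in>S. bit_sign (f (a + x)))"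
    using sum.reindex_bij_betw[OF bit_subspace_translate[OF S a(1)], of "\<lambda>x. bit_sign (f x)"] by simp
  also have "\<dots> = - (\<Sum>x\<in>S. bit_sign (f x))"
    using a by (simp add: add bit_sign_add sum_negf) (simp add: bit_sign_def sum_negf)
  finally show ?thesis using False by auto
qed

lemma bit_subspace_carrier: "bit_subspace n (carrier_vec n)"
  by (auto simp: bit_subspace_def)

text \<open>Sum the sign of \<open>v \<bullet> w\<close> over all vectors \<open>v\<close> and all \<open>w \<in> W\<close>. For fixed \<open>v\<close> the inner sum is
  \<open>card W\<close> or \<open>0\<close>, according to whether \<open>v\<close> is orthogonal to \<open>W\<close>; for fixed \<open>w\<close> it is \<open>2\<^sup>n\<close> or \<open>0\<close>,
  according to whether \<open>w = 0\<close>. A Gram-Schmidt argument would fail here, because \<open>W\<close> and its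
  complement may intersect.\<close>

lemma card_times_card_orthogonal:
  assumes W: "bit_subspace n W"
  shows "card W * card {v \<in> carrier_vec n. \<forall>w\<in>W. v \<bullet> w = 0} = 2 ^ n"
proof -
  let ?V = "carrier_vec n :: bit vec set"
  have WV: "W \<subseteq> ?V" and W0: "0\<^sub>v n \<in> W" using W by (auto simp: bit_subspace_def)
  note finW = bit_subspace_finite[OF W] and finV = card_carrier_vec_bit(1)[of n]
  have nondeg: "(\<forall>v\<in>?V. v \<bullet> w = 0) \<longleftrightarrow> w = 0\<^sub>v n" if "w \<in> ?V" for w
  proof
    assume "\<forall>v\<in>?V. v \<bullet> w = 0"
    then have "unit_vec n k \<bullet> w = 0" if "k < n" for k by simp
    then show "w = 0\<^sub>v n" using that by (intro eq_vecI) (auto simp: scalar_prod_left_unit)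
  qed (use that in auto)
  have "int (card W * card {v \<in> ?V. \<forall>w\<in>W. v \<bullet> w = 0})
      = (\<Sum>v\<in>?V. if \<forall>w\<in>W. v \<bullet> w = 0 then int (card W) else 0)"
    using finV by (simp add: sum.If_cases Int_def mult.commute)
  also have "\<dots> = (\<Sum>v\<in>?V. \<Sum>w\<in>W. bit_sign (v \<bullet> w))"
    using WV by (intro sum.cong refl sum_bit_sign[OF W, symmetric] scalar_prod_add_distrib[of _ n]) auto
  also have "\<dots> = (\<Sum>w\<in>W. \<Sum>v\<in>?V. bit_sign (v \<bullet> w))"
    by (rule sum.swap)
  also have "\<dots> = (\<Sum>w\<in>W. if \<forall>v\<in>?V. v \<bullet> w = 0 then int (card ?V) else 0)"
    using WV by (intro sum.cong refl sum_bit_sign[OF bit_subspace_carrier] add_scalar_prod_distrib[of _ n]) auto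
  also have "\<dots> = (\<Sum>w\<in>W. if w = 0\<^sub>v n then int (card ?V) else 0)"
    using WV nondeg by (intro sum.cong refl) (auto simp: subset_iff)
  also have "\<dots> = int (2 ^ n)"
    using finW W0 by (simp add: sum.delta card_carrier_vec_bit)
  finally show ?thesis by linarith
qed

section \<open>Rank as the logarithm of the size of the column space\<close>

definition column_space :: "bit mat \<Rightarrow> bit vec set" where
  "column_space A = (\<lambda>x. A *\<^sub>v x) ` carrier_vec (dim_col A)"

lemma bit_subspace_image:
  assumes A: "A \<in> carrier_mat m n" and S: "bit_subspace n S"
  shows "bit_subspace m ((\<lambda>x. A *\<^sub>v x) ` S)"
  unfolding bit_subspace_def
proof (intro conjI)
  have SC: "S \<subseteq> carrier_vec n" and S0: "0\<^sub>v n \<in> S" and SA: "\<forall>x\<in>S. \<forall>y\<in>S. x + y \<in> S"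
    using S by (auto simp: bit_subspace_def)
  show "(\<lambda>x. A *\<^sub>v x) ` S \<subseteq> carrier_vec m" using A SC by auto
  have "A *\<^sub>v 0\<^sub>v n = 0\<^sub>v m" using A by (intro eq_vecI) auto
  then show "0\<^sub>v m \<in> (\<lambda>x. A *\<^sub>v x) ` S" using S0 by (metis imageI)
  have "A *\<^sub>v x + A *\<^sub>v y \<in> (\<lambda>x. A *\<^sub>v x) ` S" if "x \<in> S" "y \<in> S" for x y
    using mult_add_distrib_mat_vec[OF A, of x y] that SC SA by (metis imageI subsetD)
  then show "\<forall>x\<in>(\<lambda>x. A *\<^sub>v x) ` S. \<forall>y\<in>(\<lambda>x. A *\<^sub>v x) ` S. x + y \<in> (\<lambda>x. A *\<^sub>v x) ` S" by auto
qed

lemma bit_subspace_column_space: "A \<in> carrier_mat m n \<Longrightarrow> bit_subspace m (column_space A)"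
  unfolding column_space_def using bit_subspace_image[OF _ bit_subspace_carrier] by auto

lemma bit_subspace_kernel:
  assumes A: "A \<in> carrier_mat m n"
  shows "bit_subspace n (mat_kernel A)"
proof -
  have "A *\<^sub>v 0\<^sub>v n = 0\<^sub>v m" using A by (intro eq_vecI) auto
  then show ?thesis
    using A by (auto simp: bit_subspace_def mat_kernel[OF A] mult_add_distrib_mat_vec[OF A])
qed

context vec_space
begin

lemma span_cols_eq_image:
  assumes A: "A \<in> carrier_mat n m"
  shows "span (set (cols A)) = (\<lambda>x. A *\<^sub>v x) ` carrier_vec m"
proof -
  have c: "set (cols A) \<subseteq> carrier_vec n" using A cols_dim by blast
  have mc: "mat_of_cols n (cols A) = A" and len: "length (cols A) = m"
    using mat_of_cols_cols[of A] A by simp_all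
  have "\<forall>w\<in>set (cols A). dim_vec w = n" using c carrier_vecD by blast
  then have lc: "lincomb_list f (cols A) = A *\<^sub>v vec m f" for f
    using lincomb_list_as_mat_mult[of "cols A" f] unfolding mc len by blast
  have "span_list (cols A) = range (\<lambda>f. A *\<^sub>v vec m f)"
    unfolding span_list_def lc by auto
  also have "\<dots> = (\<lambda>x. A *\<^sub>v x) ` carrier_vec m"
  proof (intro equalityI subsetI)
    fix y assume "y \<in> (\<lambda>x. A *\<^sub>v x) ` carrier_vec m"
    then obtain x where x: "x \<in> carrier_vec m" "y = A *\<^sub>v x" by blast
    have "x = vec m (\<lambda>i. x $ i)" using x(1) by (intro eq_vecI) auto
    then show "y \<in> range (\<lambda>f. A *\<^sub>v vec m f)" using x(2) by (metis rangeI)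
  qed auto
  finally show ?thesis using span_list_as_span[OF c] by simp
qed

end

context vec_space
begin

text \<open>Vectors of the span correspond to coefficient functions on \<open>T\<close>, extended by a dummy value
  outside \<open>T\<close> so that the functions can be counted.\<close>

lemma card_span_lin_indpt:
  assumes fin: "finite T"
    and T: "T \<subseteq> carrier_vec n" and indpt: "lin_indpt T"
  shows "card (span T) = card (UNIV :: 'a set) ^ card T"
proof -
  have image: "span T = (\<lambda>a. lincomb a T) ` (PiE T (\<lambda>_. UNIV))"
  proof (intro equalityI subsetI)
    fix y assume "y \<in> span T"
    then obtain a where "y = lincomb a T" using finite_span[OF fin] T by auto
    moreover have "lincomb a T = lincomb (restrict a T) T"
      using T by (intro lincomb_cong) auto
    ultimately show "y \<in> (\<lambda>a. lincomb a T) ` (PiE T (\<lambda>_. UNIV))"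
      by (intro image_eqI[of _ _ "restrict a T"]) auto
  qed (use finite_span[OF fin] T in auto)
  have "inj_on (\<lambda>a. lincomb a T) (PiE T (\<lambda>_. UNIV))"
  proof (rule inj_onI)
    fix a b assume a: "a \<in> PiE T (\<lambda>_. UNIV)" and b: "b \<in> PiE T (\<lambda>_. UNIV)"
      and eq: "lincomb a T = lincomb b T"
    have "lincomb (\<lambda>x. a x - b x) T = 0\<^sub>v n"
    proof (rule eq_vecI)
      fix i assume "i < dim_vec (0\<^sub>v n :: 'a vec)"
      then have i: "i < n" by simp
      have "(\<Sum>x\<in>T. a x * x $ i) = (\<Sum>x\<in>T. b x * x $ i)"
        using arg_cong[OF eq, of "\<lambda>v. v $ i"] unfolding lincomb_index[OF i T] .
      then show "lincomb (\<lambda>x. a x - b x) T $ i = 0\<^sub>v n $ i"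
        using i unfolding lincomb_index[OF i T] by (simp add: left_diff_distrib sum_subtractf)
    qed (use fin T lincomb_dim in auto)
    then have "(\<lambda>x. a x - b x) \<in> T \<rightarrow> {0}"
      using not_lindepD[OF indpt fin subset_refl, of "\<lambda>x. a x - b x"] by simp
    then have "a x = b x" if "x \<in> T" for x using that by auto
    then show "a = b" using a b by (intro PiE_ext) auto
  qed
  then show ?thesis
    unfolding image by (simp add: card_image card_PiE fin)
qed

lemma card_span_cols:
  assumes A: "A \<in> carrier_mat n m"
  shows "card (span (set (cols A))) = card (UNIV :: 'a set) ^ rank A"
proof -
  let ?S = "set (cols A)"
  have S: "?S \<subseteq> carrier_vec n" using A cols_dim by blast
  have sub: "submodule class_ring (span ?S) V" using S by (simp add: span_is_submodule)
  interpret W: vectorspace class_ring "span_vs ?S"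
    using S by (simp add: span_is_subspace subspace_is_vs)
  obtain B where finB: "finite B" and B: "W.basis B"
    using W.finite_basis_exists fin_dim_span_cols[OF A] by blast
  have BS: "B \<subseteq> span ?S" and indB: "W.lin_indpt B" and genB: "W.span B = span ?S"
    using B by (simp_all add: W.basis_def)
  have "span B = span ?S" and "lin_indpt B"
    using span_li_not_depend[OF BS sub] genB indB by simp_all
  moreover have "B \<subseteq> carrier_vec n" using BS span_closed S by auto
  ultimately show ?thesis
    using card_span_lin_indpt[OF finB] W.dim_basis[OF finB B] by (simp add: rank_def)
qed

end

lemma card_column_space:
  assumes A: "A \<in> carrier_mat n m"
  shows "card (column_space A) = 2 ^ vec_space.rank n A"
proof -
  interpret vec_space "TYPE(bit)" n .
  show ?thesis
    using card_span_cols[OF A] span_cols_eq_image[OF A] A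
    by (simp add: column_space_def card_UNIV_bit)
qed

text \<open>The adjunction \<open>v \<bullet> (U x) = (U\<^sup>T v) \<bullet> x\<close> identifies the kernel of the transpose with an
  orthogonal complement, which gives its size without knowing that row rank equals column
  rank.\<close>

lemma mat_kernel_transpose:
  assumes U: "U \<in> carrier_mat m n"
  shows "mat_kernel (transpose_mat U) = {v \<in> carrier_vec m. \<forall>w\<in>column_space U. v \<bullet> w = (0 :: bit)}"
proof -
  have "transpose_mat U *\<^sub>v v = 0\<^sub>v n \<longleftrightarrow> (\<forall>w\<in>column_space U. v \<bullet> w = 0)"
    if v: "v \<in> carrier_vec m" for v
  proof -
    have adj: "v \<bullet> (U *\<^sub>v x) = (transpose_mat U *\<^sub>v v) \<bullet> x" if "x \<in> carrier_vec n" for x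
      using transpose_vec_mult_scalar[OF U that v] by simp
    have Uv: "transpose_mat U *\<^sub>v v \<in> carrier_vec n"
      using mult_mat_vec_carrier[of "transpose_mat U" n m v] U v by simp
    show ?thesis
    proof
      assume "\<forall>w\<in>column_space U. v \<bullet> w = 0"
      then have "(transpose_mat U *\<^sub>v v) \<bullet> x = 0" if "x \<in> carrier_vec n" for x
        using adj[OF that] that U by (simp add: column_space_def)
      then have "(transpose_mat U *\<^sub>v v) $ k = 0" if "k < n" for k
        using scalar_prod_right_unit[OF that, of "transpose_mat U *\<^sub>v v"] by (metis unit_vec_carrier)
      then show "transpose_mat U *\<^sub>v v = 0\<^sub>v n" using Uv U by (intro eq_vecI) auto
    qed (use adj U in \<open>auto simp: column_space_def\<close>)
  qed
  then show ?thesis using U by (auto simp: mat_kernel[of "transpose_mat U" n m])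
qed

lemma card_mat_kernel_transpose:
  fixes U :: "bit mat"
  assumes U: "U \<in> carrier_mat m n"
  shows "2 ^ vec_space.rank m U * card (mat_kernel (transpose_mat U)) = (2 ^ m :: nat)"
  using card_times_card_orthogonal[OF bit_subspace_column_space[OF U]]
  unfolding mat_kernel_transpose[OF U] card_column_space[OF U] .

lemma card_mat_kernel:
  fixes U :: "bit mat"
  assumes U: "U \<in> carrier_mat m n"
  shows "card (mat_kernel U) * 2 ^ vec_space.rank m U = (2 ^ n :: nat)"
proof -
  have "card (carrier_vec n :: bit vec set)
      = card {x \<in> carrier_vec n. U *\<^sub>v x = 0\<^sub>v m} * card ((\<lambda>x. U *\<^sub>v x) ` carrier_vec n)"
    by (rule card_kernel_times_image[OF bit_subspace_carrier])
      (use U in \<open>simp_all add: mult_add_distrib_mat_vec\<close>)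
  then show ?thesis
    using U card_column_space[OF U] by (simp add: mat_kernel[OF U] column_space_def card_carrier_vec_bit)
qed

section \<open>Bordering a triangular matrix\<close>

definition border :: "bit mat \<Rightarrow> bit vec \<Rightarrow> bit \<Rightarrow> bit mat" where
  "border U b c = four_block_mat U (mat_of_cols (dim_row U) [b])
     (0\<^sub>m 1 (dim_col U)) (mat 1 1 (\<lambda>_. c))"

lemma border_carrier: "U \<in> carrier_mat n n \<Longrightarrow> border U b c \<in> carrier_mat (Suc n) (Suc n)"
  using four_block_carrier_mat[of U n n "mat 1 1 (\<lambda>_. c)" 1 1] by (simp add: border_def Suc_eq_plus1)

lemma index_border:
  assumes "U \<in> carrier_mat n n" "b \<in> carrier_vec n" "i < Suc n" "j < Suc n"
  shows "border U b c $$ (i, j) =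
    (if j < n then if i < n then U $$ (i, j) else 0 else if i < n then b $ i else c)"
  using assms by (auto simp: border_def mat_of_cols_index)

lemma border_inject:
  assumes U: "U \<in> carrier_mat n n" "U' \<in> carrier_mat n n" and b: "b \<in> carrier_vec n" "b' \<in> carrier_vec n"
    and eq: "border U b c = border U' b' c'"
  shows "U = U' \<and> b = b'"
proof
  have e: "border U b c $$ (i, j) = border U' b' c' $$ (i, j)" for i j using eq by simp
  show "U = U'"
  proof (rule eq_matI)
    fix i j assume "i < dim_row U'" "j < dim_col U'"
    then have "i < n" "j < n" using U by auto
    then show "U $$ (i, j) = U' $$ (i, j)"
      using e[of i j] index_border[OF U(1) b(1), of i j c] index_border[OF U(2) b(2), of i j c'] by simp
  qed (use U in auto)
  show "b = b'"
  proof (rule eq_vecI)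
    fix i assume "i < dim_vec b'"
    then have "i < n" using b by auto
    then show "b $ i = b' $ i"
      using e[of i n] index_border[OF U(1) b(1), of i n c] index_border[OF U(2) b(2), of i n c'] by simp
  qed (use b in auto)
qed

lemma upper_triangular_border:
  assumes U: "U \<in> carrier_mat n n"
  shows "upper_triangular (border U b c) \<longleftrightarrow> upper_triangular U"
proof
  assume "upper_triangular U"
  then show "upper_triangular (border U b c)"
    unfolding border_def using U upper_triangular_four_block[of U n "mat 1 1 (\<lambda>_. c)" 1]
    by (auto simp: upper_triangular_def)
next
  assume ut: "upper_triangular (border U b c)"
  show "upper_triangular U"
  proof (rule upper_triangularI)
    fix i j assume "j < i" "i < dim_row U"
    then show "U $$ (i, j) = 0"
      using upper_triangularD[OF ut, of j i] U by (simp add: border_def)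
  qed
qed

lemma upper_triangular_Suc_border:
  assumes A: "A \<in> carrier_mat (Suc n) (Suc n)" and ut: "upper_triangular A"
  shows "\<exists>U b c. U \<in> carrier_mat n n \<and> b \<in> carrier_vec n \<and> A = border U b c"
proof (intro exI conjI)
  let ?U = "mat n n (\<lambda>ij. A $$ ij)" and ?b = "vec n (\<lambda>i. A $$ (i, n))"
  show "A = border ?U ?b (A $$ (n, n))"
  proof (rule eq_matI)
    fix i j assume "i < dim_row (border ?U ?b (A $$ (n, n)))" "j < dim_col (border ?U ?b (A $$ (n, n)))"
    then have ij: "i < Suc n" "j < Suc n"
      using border_carrier[of ?U n ?b "A $$ (n, n)"] by auto
    moreover have "A $$ (i, j) = 0" if "\<not> i < n" "j < n"
      using upper_triangularD[OF ut, of j i] that ij A by simp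
    ultimately show "A $$ (i, j) = border ?U ?b (A $$ (n, n)) $$ (i, j)"
      by (subst index_border[of _ n]) (auto simp: less_Suc_eq)
  qed (use A border_carrier[of ?U n ?b "A $$ (n, n)"] in auto)
qed auto

lemma gram_eq_iff:
  assumes "A \<in> carrier_mat m n" "D \<in> carrier_mat n n"
  shows "transpose_mat A * A = D \<longleftrightarrow> (\<forall>i<n. \<forall>j<n. col A i \<bullet> col A j = D $$ (i, j))"
proof
  assume "transpose_mat A * A = D"
  then show "\<forall>i<n. \<forall>j<n. col A i \<bullet> col A j = D $$ (i, j)" using assms by auto
qed (use assms in \<open>auto intro!: eq_matI\<close>)

lemma col_border:
  assumes U: "U \<in> carrier_mat n n" and b: "b \<in> carrier_vec n"
  shows "j < n \<Longrightarrow> col (border U b c) j = col U j @\<^sub>v vec 1 (\<lambda>_. 0)"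
    and "col (border U b c) n = b @\<^sub>v vec 1 (\<lambda>_. c)"
  using U b border_carrier[OF U, of b c] 
  by (auto intro!: eq_vecI simp: index_border index_append_vec)

lemma scalar_prod_append_single:
  assumes "x \<in> carrier_vec n" "y \<in> carrier_vec n"
  shows "(x @\<^sub>v vec 1 (\<lambda>_. s)) \<bullet> (y @\<^sub>v vec 1 (\<lambda>_. t)) = x \<bullet> y + s * (t :: bit)"
  using assms by (subst scalar_prod_append[of _ n _ 1]) (auto simp: scalar_prod_def)

lemma diag_prefix_carrier: "diag_prefix d n \<in> carrier_mat n n"
  by (simp add: diag_prefix_def)

lemma index_diag_prefix:
  "i < n \<Longrightarrow> j < n \<Longrightarrow> diag_prefix d n $$ (i, j) = (if i = j then of_nat (d (Suc i)) else 0)"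
  by (simp add: diag_prefix_def mat_diag_def)

text \<open>Read the Gram matrix off the columns \<open>(U e\<^sub>j, 0)\<close> and \<open>(b, c)\<close> of the bordered matrix. As
  \<open>c\<^sup>2 = c\<close> and \<open>- 1 = 1\<close>, the condition on the corner entry can be solved for \<open>c\<close>.\<close>

lemma border_factorization_iff:
  assumes U: "U \<in> carrier_mat n n" and b: "b \<in> carrier_vec n"
  shows "transpose_mat (border U b c) * border U b c = diag_prefix d (Suc n) \<longleftrightarrow>
    transpose_mat U * U = diag_prefix d n \<and> b \<in> mat_kernel (transpose_mat U)
      \<and> c = of_nat (d (Suc n)) + b \<bullet> b" (is "?gram \<longleftrightarrow> ?U \<and> ?b \<and> ?c")
proof -
  let ?A = "border U b c"
  let ?P = "\<lambda>i j. col ?A i \<bullet> col ?A j = diag_prefix d (Suc n) $$ (i, j)"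
  have colU: "col U i \<in> carrier_vec n" for i using U by auto
  have cc: "c * c = c" by (cases c) simp_all
  have "?gram \<longleftrightarrow> (\<forall>i<Suc n. \<forall>j<Suc n. ?P i j)"
    by (rule gram_eq_iff[OF border_carrier[OF U] diag_prefix_carrier])
  also have "\<dots> \<longleftrightarrow> (\<forall>i<n. \<forall>j<n. ?P i j) \<and> (\<forall>i<n. ?P i n \<and> ?P n i) \<and> ?P n n"
    by (auto simp: less_Suc_eq)
  also have "(\<forall>i<n. \<forall>j<n. ?P i j) \<longleftrightarrow> ?U"
    unfolding gram_eq_iff[OF U diag_prefix_carrier]
    by (simp add: col_border[OF U b] scalar_prod_append_single[OF colU colU] index_diag_prefix)
  also have "(\<forall>i<n. ?P i n \<and> ?P n i) \<longleftrightarrow> (\<forall>i<n. col U i \<bullet> b = 0)"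
    using comm_scalar_prod[OF b colU]
    by (auto simp: col_border[OF U b] scalar_prod_append_single[OF colU b]
        scalar_prod_append_single[OF b colU] index_diag_prefix)
  also have "\<dots> \<longleftrightarrow> ?b"
    using U b by (auto simp: mat_kernel[of _ n n] vec_eq_iff)
  also have "?P n n \<longleftrightarrow> b \<bullet> b + c = of_nat (d (Suc n))"
    by (simp add: col_border[OF U b] scalar_prod_append_single[OF b b] index_diag_prefix cc)
  also have "\<dots> \<longleftrightarrow> ?c"
    by (cases "b \<bullet> b"; cases c; cases "of_nat (d (Suc n)) :: bit") simp_all
  finally show ?thesis .
qed

lemma border_mult_vec:
  assumes U: "U \<in> carrier_mat n n" and b: "b \<in> carrier_vec n" and x: "x \<in> carrier_vec n"
  shows "border U b c *\<^sub>v (x @\<^sub>v vec 1 (\<lambda>_. y)) = (U *\<^sub>v x + y \<cdot>\<^sub>v b) @\<^sub>v vec 1 (\<lambda>_. y * c)"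
proof -
  have "mat_of_cols n [b] *\<^sub>v vec 1 (\<lambda>_. y) = y \<cdot>\<^sub>v b"
    using b by (intro eq_vecI) (auto simp: scalar_prod_def mat_of_cols_index mult.commute)
  moreover have "0\<^sub>m 1 n *\<^sub>v x + mat 1 1 (\<lambda>_. c) *\<^sub>v vec 1 (\<lambda>_. y) = vec 1 (\<lambda>_. y * c)"
    using x by (intro eq_vecI) (auto simp: scalar_prod_def mult.commute)
  moreover have "mat_of_cols n [b] \<in> carrier_mat n 1"
    using mat_of_cols_carrier(1)[of n "[b]"] by (simp add: One_nat_def)
  ultimately show ?thesis
    using U x four_block_mat_mult_vec[of U n n "mat_of_cols n [b]" 1 "0\<^sub>m 1 n" 1 "mat 1 1 (\<lambda>_. c)"
        x "vec 1 (\<lambda>_. y)"]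
    by (simp add: border_def)
qed

text \<open>The column space of the bordered matrix is the column space of \<open>U\<close>, embedded by appending a zero,
  with the vector \<open>(b, c)\<close> adjoined.\<close>

lemma card_column_space_border:
  assumes U: "U \<in> carrier_mat n n" and b: "b \<in> carrier_vec n"
  shows "card (column_space (border U b c)) =
    (if c = 0 \<and> b \<in> column_space U then card (column_space U) else 2 * card (column_space U))"
proof -
  let ?E = "\<lambda>w :: bit vec. w @\<^sub>v vec 1 (\<lambda>_. 0)"
  let ?a = "b @\<^sub>v vec 1 (\<lambda>_. c)"
  let ?W = "column_space U"
  have W: "bit_subspace n ?W" by (rule bit_subspace_column_space[OF U])
  then have WC: "w \<in> carrier_vec n" if "w \<in> ?W" for w using that by (auto simp: bit_subspace_def)
  have app: "(x @\<^sub>v vec 1 (\<lambda>_. s)) + (y @\<^sub>v vec 1 (\<lambda>_. t)) = (x + y) @\<^sub>v vec 1 (\<lambda>_. s + t)"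
    if "x \<in> carrier_vec n" "y \<in> carrier_vec n" for x y and s t :: bit
    using that by (subst append_vec_add[of _ n _ _ 1]) (auto intro!: arg_cong[of _ _ "(@\<^sub>v) _"])
  have E: "bit_subspace (Suc n) (?E ` ?W)"
    unfolding bit_subspace_def
  proof (intro conjI)
    show "?E ` ?W \<subseteq> carrier_vec (Suc n)"
      using WC append_carrier_vec[of _ n "vec 1 (\<lambda>_. 0)" 1] by (auto simp: Suc_eq_plus1)
    have "0\<^sub>v (Suc n) = ?E (0\<^sub>v n)" by (intro eq_vecI) (auto simp: index_append_vec)
    then show "0\<^sub>v (Suc n) \<in> ?E ` ?W" using W by (auto simp: bit_subspace_def)
    show "\<forall>x\<in>?E ` ?W. \<forall>y\<in>?E ` ?W. x + y \<in> ?E ` ?W"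
      using W WC by (auto simp: app bit_subspace_def)
  qed
  have a: "?a \<in> carrier_vec (Suc n)" using append_carrier_vec[OF b, of "vec 1 (\<lambda>_. c)" 1] by (simp add: Suc_eq_plus1)
  have "column_space (border U b c) =
      (\<lambda>x. border U b c *\<^sub>v x) ` {x @\<^sub>v vec 1 (\<lambda>_. y) | x y. x \<in> carrier_vec n}"
  proof -
    have "carrier_vec (Suc n) = {x @\<^sub>v vec 1 (\<lambda>_. y) | x y. x \<in> (carrier_vec n :: bit vec set)}"
    proof (intro equalityI subsetI)
      fix z :: "bit vec" assume "z \<in> carrier_vec (Suc n)"
      then have "z = vec n (\<lambda>i. z $ i) @\<^sub>v vec 1 (\<lambda>_. z $ n)"
        by (intro eq_vecI) (auto simp: index_append_vec intro!: arg_cong[of _ n "\<lambda>i. z $ i"])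
      moreover have "vec n (\<lambda>i. z $ i) \<in> carrier_vec n" by simp
      ultimately show "z \<in> {x @\<^sub>v vec 1 (\<lambda>_. y) | x y. x \<in> carrier_vec n}" by blast
    next
      fix z :: "bit vec" assume "z \<in> {x @\<^sub>v vec 1 (\<lambda>_. y) | x y. x \<in> carrier_vec n}"
      then show "z \<in> carrier_vec (Suc n)" using append_carrier_vec[of _ n "vec 1 _" 1] by (auto simp: Suc_eq_plus1)
    qed
    then show ?thesis using border_carrier[OF U, of b c] by (simp add: column_space_def)
  qed
  also have "\<dots> = {border U b c *\<^sub>v (x @\<^sub>v vec 1 (\<lambda>_. y)) | x y. x \<in> carrier_vec n}"
    by blast
  also have "\<dots> = {(U *\<^sub>v x + y \<cdot>\<^sub>v b) @\<^sub>v vec 1 (\<lambda>_. y * c) | x y. x \<in> carrier_vec n}"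
    by (intro Collect_cong ex_cong1) (auto simp: border_mult_vec[OF U b])
  also have "\<dots> = {(w + y \<cdot>\<^sub>v b) @\<^sub>v vec 1 (\<lambda>_. y * c) | w y. w \<in> ?W}"
    using U by (auto simp: column_space_def)
  also have "\<dots> = ?E ` ?W \<union> (\<lambda>x. ?a + x) ` (?E ` ?W)"
  proof -
    have zero: "0 \<cdot>\<^sub>v b = 0\<^sub>v n" using b by (intro eq_vecI) auto
    let ?h = "\<lambda>w y. (w + y \<cdot>\<^sub>v b) @\<^sub>v vec 1 (\<lambda>_. y * c)"
    have h: "?h w 0 = ?E w" "?h w 1 = ?a + ?E w" if "w \<in> ?W" for w
      using WC[OF that] b comm_add_vec[of b n w] by (simp_all add: app zero)
    show ?thesis
    proof (intro equalityI subsetI)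
      fix z assume "z \<in> {?h w y | w y. w \<in> ?W}"
      then obtain w y where w: "w \<in> ?W" and z: "z = ?h w y" by blast
      show "z \<in> ?E ` ?W \<union> (\<lambda>x. ?a + x) ` (?E ` ?W)"
      proof (cases y)
        assume "y = 0"
        then show ?thesis using z w h(1)[OF w] by blast
      next
        assume "y = 1"
        then show ?thesis using z w h(2)[OF w] by blast
      qed
    next
      fix z assume "z \<in> ?E ` ?W \<union> (\<lambda>x. ?a + x) ` (?E ` ?W)"
      then obtain w where w: "w \<in> ?W" and z: "z = ?E w \<or> z = ?a + ?E w" by blast
      then have "z = ?h w 0 \<or> z = ?h w 1" using h[OF w] by simp
      then show "z \<in> {?h w y | w y. w \<in> ?W}" using w by blast
    qed
  qed
  finally have "card (column_space (border U b c)) =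
      (if ?a \<in> ?E ` ?W then card (?E ` ?W) else 2 * card (?E ` ?W))"
    using card_adjoin[OF E a] by simp
  moreover have "card (?E ` ?W) = card ?W"
    using WC by (intro card_image inj_onI) (metis append_vec_eq)
  moreover have "?a \<in> ?E ` ?W \<longleftrightarrow> c = 0 \<and> b \<in> ?W"
  proof -
    have "vec 1 (\<lambda>_. c) = vec 1 (\<lambda>_. 0) \<longleftrightarrow> c = 0"
      by (metis index_vec less_numeral_extra(1))
    then have "?a = ?E w \<longleftrightarrow> c = 0 \<and> b = w" if "w \<in> ?W" for w
      using append_vec_eq[OF b WC[OF that]] by auto
    then show ?thesis by auto
  qed
  ultimately show ?thesis by simp
qed

lemma rank_border:
  assumes U: "U \<in> carrier_mat n n" and b: "b \<in> carrier_vec n"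
  shows "vec_space.rank (Suc n) (border U b c) =
    (if c = 0 \<and> b \<in> column_space U then vec_space.rank n U else Suc (vec_space.rank n U))"
proof -
  have "(2::nat) ^ vec_space.rank (Suc n) (border U b c) =
      2 ^ (if c = 0 \<and> b \<in> column_space U then vec_space.rank n U else Suc (vec_space.rank n U))"
    using card_column_space_border[OF U b, of c]
    by (simp add: card_column_space[OF U] card_column_space[OF border_carrier[OF U]])
  then show ?thesis by (rule power_inject_exp[THEN iffD1, rotated]) simp
qed

section \<open>The triangular factors of a diagonal matrix\<close>

definition triangular_factors :: "(nat \<Rightarrow> nat) \<Rightarrow> nat \<Rightarrow> bit mat set" where
  "triangular_factors d n = {U \<in> carrier_mat n n. upper_triangular U \<and> transpose_mat U * U = diag_prefix d n}"

lemma triangular_factors_Suc: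
  "bij_betw (\<lambda>(U, b). border U b (of_nat (d (Suc n)) + b \<bullet> b))
     (SIGMA U:triangular_factors d n. mat_kernel (transpose_mat U)) (triangular_factors d (Suc n))"
proof (rule bij_betw_imageI)
  let ?S = "SIGMA U:triangular_factors d n. mat_kernel (transpose_mat U)"
  let ?f = "\<lambda>(U, b). border U b (of_nat (d (Suc n)) + b \<bullet> b)"
  have S: "U \<in> carrier_mat n n" "b \<in> carrier_vec n" if "(U, b) \<in> ?S" for U b
    using that mat_kernel[of "transpose_mat U" n n] by (auto simp: triangular_factors_def)
  show "inj_on ?f ?S"
    by (intro inj_onI) (use S border_inject[of _ n] in \<open>clarsimp, metis\<close>)
  show "?f ` ?S = triangular_factors d (Suc n)"
  proof (intro equalityI subsetI)
    fix A assume "A \<in> ?f ` ?S"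
    then obtain U b where Ub: "(U, b) \<in> ?S" and A: "A = border U b (of_nat (d (Suc n)) + b \<bullet> b)"
      by auto
    then show "A \<in> triangular_factors d (Suc n)"
      using S[OF Ub] border_factorization_iff[OF S[OF Ub]] border_carrier[OF S(1)[OF Ub]]
        upper_triangular_border[OF S(1)[OF Ub]]
      by (auto simp: triangular_factors_def)
  next
    fix A assume A: "A \<in> triangular_factors d (Suc n)"
    then obtain U b c where U: "U \<in> carrier_mat n n" and b: "b \<in> carrier_vec n" and Ab: "A = border U b c"
      using upper_triangular_Suc_border[of A n] by (auto simp: triangular_factors_def)
    have "U \<in> triangular_factors d n" "b \<in> mat_kernel (transpose_mat U)" "c = of_nat (d (Suc n)) + b \<bullet> b"
      using A border_factorization_iff[OF U b] upper_triangular_border[OF U] U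
      unfolding Ab triangular_factors_def by auto
    then show "A \<in> ?f ` ?S" unfolding Ab by (intro image_eqI[of _ _ "(U, b)"]) auto
  qed
qed

lemma finite_mat_kernel_bit: "finite (mat_kernel (A :: bit mat))"
  using bit_subspace_finite[OF bit_subspace_kernel[of A "dim_row A" "dim_col A"]] by auto

lemma finite_triangular_factors: "finite (triangular_factors d n)"
proof (induction n)
  case 0
  have "triangular_factors d 0 \<subseteq> {1\<^sub>m 0}" using carrier_mat_0_0 by (auto simp: triangular_factors_def)
  then show ?case by (rule finite_subset) simp
next
  case (Suc n)
  then have "finite (SIGMA U:triangular_factors d n. mat_kernel (transpose_mat U))"
    by (intro finite_SigmaI finite_mat_kernel_bit)
  then show ?case using bij_betw_finite[OF triangular_factors_Suc] by blast
qed

lemma card_triangular_factors_Suc_filter: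
  "card {A \<in> triangular_factors d (Suc n). P A} =
    (\<Sum>U\<in>triangular_factors d n. card {b \<in> mat_kernel (transpose_mat U). P (border U b (of_nat (d (Suc n)) + b \<bullet> b))})"
proof -
  let ?f = "\<lambda>(U, b). border U b (of_nat (d (Suc n)) + b \<bullet> b)"
  let ?K = "\<lambda>U. mat_kernel (transpose_mat U)"
  let ?T = "SIGMA U:triangular_factors d n. {b \<in> ?K U. P (?f (U, b))}"
  have img: "?f ` ?T = {A \<in> triangular_factors d (Suc n). P A}"
  proof (intro equalityI subsetI)
    fix A assume A: "A \<in> {A \<in> triangular_factors d (Suc n). P A}"
    then have "A \<in> ?f ` (SIGMA U:triangular_factors d n. ?K U)"
      using bij_betw_imp_surj_on[OF triangular_factors_Suc[of d n]] by simp
    then obtain z where "z \<in> (SIGMA U:triangular_factors d n. ?K U)" "A = ?f z" by (rule imageE)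
    then show "A \<in> ?f ` ?T" using A by (intro image_eqI[of _ _ z]) auto
  next
    fix A assume "A \<in> ?f ` ?T"
    then show "A \<in> {A \<in> triangular_factors d (Suc n). P A}"
      using bij_betw_apply[OF triangular_factors_Suc[of d n]] by auto
  qed
  have "inj_on ?f ?T"
    by (rule inj_on_subset[OF bij_betw_imp_inj_on[OF triangular_factors_Suc[of d n]]]) auto
  then have "card {A \<in> triangular_factors d (Suc n). P A} = card ?T"
    unfolding img[symmetric] by (rule card_image)
  also have "\<dots> = (\<Sum>U\<in>triangular_factors d n. card {b \<in> ?K U. P (?f (U, b))})"
    by (rule card_SigmaI) (auto simp: finite_triangular_factors finite_mat_kernel_bit)
  finally show ?thesis by simp
qed

text \<open>Such a \<open>b\<close> belongs to a space and to its orthogonal complement.\<close>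

lemma kernel_inter_column_space_isotropic:
  assumes U: "U \<in> carrier_mat n n" and b: "b \<in> mat_kernel (transpose_mat U)" "b \<in> column_space U"
  shows "b \<bullet> b = 0"
  using b unfolding mat_kernel_transpose[OF U] by blast

lemma ones_Suc: "ones d (Suc n) = ones d n + d (Suc n)"
  by (simp add: ones_def)

text \<open>A vector is killed by the diagonal matrix iff it vanishes wherever the diagonal has a one. The
  statement is multiplicative in order to avoid a truncated subtraction in the exponent.\<close>

lemma card_kernel_diag_prefix:
  assumes d: "\<And>j. 1 \<le> j \<Longrightarrow> j \<le> n \<Longrightarrow> d j \<in> {0, 1}"
  shows "2 ^ ones d n * card (mat_kernel (diag_prefix d n)) = 2 ^ n"
proof -
  let ?A = "\<lambda>k. if d (Suc k) = 0 then UNIV else {0 :: bit}"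
  have "(diag_prefix d n *\<^sub>v x) $ k = of_nat (d (Suc k)) * x $ k"
    if "x \<in> carrier_vec n" "k < n" for x k
    using that by (simp add: diag_prefix_def mat_diag_def scalar_prod_def if_distrib[of "\<lambda>y. y * _"] cong: if_cong)
  then have "diag_prefix d n *\<^sub>v x = 0\<^sub>v n \<longleftrightarrow> (\<forall>k<n. of_nat (d (Suc k)) * x $ k = 0)"
    if "x \<in> carrier_vec n" for x
    using that carrier_matD[OF diag_prefix_carrier[of d n]] by (auto simp: vec_eq_iff)
  moreover have "of_nat (d (Suc k)) * x = 0 \<longleftrightarrow> x \<in> ?A k" if "k < n" for x k
    using d[of "Suc k"] that by auto
  ultimately have "mat_kernel (diag_prefix d n) = {x \<in> carrier_vec n. \<forall>k<n. x $ k \<in> ?A k}"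
    unfolding mat_kernel[OF diag_prefix_carrier] by blast
  then have "card (mat_kernel (diag_prefix d n)) = (\<Prod>k<n. card (?A k))"
    using card_box_vec(2)[of n ?A] by (simp add: card_UNIV_bit)
  moreover have "2 ^ ones d n * (\<Prod>k<n. card (?A k)) = 2 ^ n"
    using d
  proof (induction n)
    case (Suc n)
    then have "2 ^ ones d n * (\<Prod>k<n. card (?A k)) = 2 ^ n" and "d (Suc n) \<in> {0, 1}" by auto
    then show ?case by (auto simp: ones_Suc card_UNIV_bit power_add)
  qed (simp add: ones_def)
  ultimately show ?thesis by simp
qed

text \<open>The linear algebra behind the recurrences. The set \<open>K \<inter> column_space U\<close> is the image of the kernel
  of \<open>U\<^sup>T U\<close> under \<open>U\<close>, so rank-nullity for \<open>U\<close> on that kernel gives its size. That this size is a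
  positive integer yields the first inequality, and comparing it with \<open>card K\<close> the third.\<close>

lemma factor_counts:
  assumes d: "\<And>j. 1 \<le> j \<Longrightarrow> j \<le> n \<Longrightarrow> d j \<in> {0, 1}" and U: "U \<in> triangular_factors d n"
  defines "r \<equiv> vec_space.rank n U" and "K \<equiv> mat_kernel (transpose_mat U)"
  shows "ones d n \<le> r" and "r \<le> n" and "r - ones d n \<le> n - r"
    and "card K = 2 ^ (n - r)"
    and "card (K \<inter> column_space U) = 2 ^ (r - ones d n)"
proof -
  have Uc: "U \<in> carrier_mat n n" and UU: "transpose_mat U * U = diag_prefix d n"
    using U by (auto simp: triangular_factors_def)
  let ?D = "mat_kernel (diag_prefix d n)"
  have UtU: "transpose_mat U *\<^sub>v (U *\<^sub>v x) = diag_prefix d n *\<^sub>v x" if "x \<in> carrier_vec n" for x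
    using assoc_mult_mat_vec[of "transpose_mat U" n n U n x] Uc UU that by simp
  have Ut: "transpose_mat U \<in> carrier_mat n n" using Uc by simp
  have K: "2 ^ r * card K = 2 ^ n"
    using card_mat_kernel_transpose[OF Uc] by (simp add: r_def K_def)
  show "r \<le> n"
    using K by (metis dvd_triv_left power_dvd_imp_le one_less_numeral_iff semiring_norm(76))
  then have "2 ^ r * card K = 2 ^ r * 2 ^ (n - r)" using K by (simp flip: power_add)
  then show cK: "card K = 2 ^ (n - r)" by simp
  \<comment> \<open>An element \<open>U x\<close> of the column space lies in \<open>K\<close> iff \<open>U\<^sup>T U x = 0\<close>, that is, iff \<open>x \<in> ?D\<close>.\<close>
  have image: "(\<lambda>x. U *\<^sub>v x) ` ?D = K \<inter> column_space U"
    using Uc by (auto simp: K_def column_space_def mat_kernel[OF Ut] mat_kernel[OF diag_prefix_carrier] UtU)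
  have "{x \<in> ?D. U *\<^sub>v x = 0\<^sub>v n} = mat_kernel U"
  proof -
    have "diag_prefix d n *\<^sub>v x = 0\<^sub>v n" if "x \<in> carrier_vec n" "U *\<^sub>v x = 0\<^sub>v n" for x
      using UtU[OF that(1)] that(2) Ut by (auto simp: vec_eq_iff)
    then show ?thesis by (auto simp: mat_kernel[OF Uc] mat_kernel[OF diag_prefix_carrier])
  qed
  moreover have "card ?D = card {x \<in> ?D. U *\<^sub>v x = 0\<^sub>v n} * card ((\<lambda>x. U *\<^sub>v x) ` ?D)"
    by (rule card_kernel_times_image[OF bit_subspace_kernel[OF diag_prefix_carrier]])
      (use Uc in \<open>auto simp: mat_kernel[OF diag_prefix_carrier] mult_add_distrib_mat_vec\<close>)
  ultimately have D: "card ?D = card (mat_kernel U) * card (K \<inter> column_space U)"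
    using image by simp
  \<comment> \<open>With \<open>s = ones d n\<close>, all sizes are powers of two: \<open>card ?D = 2\<^sup>n\<^sup>-\<^sup>s\<close> and \<open>card (mat_kernel U) = 2\<^sup>n\<^sup>-\<^sup>r\<close>.\<close>
  have "2 ^ n * 2 ^ r = 2 ^ ones d n * card ?D * 2 ^ r"
    using card_kernel_diag_prefix[OF d] by simp
  also have "\<dots> = 2 ^ n * (2 ^ ones d n * card (K \<inter> column_space U))"
    using card_mat_kernel[OF Uc] unfolding D r_def by (simp add: algebra_simps)
  finally have *: "2 ^ r = 2 ^ ones d n * card (K \<inter> column_space U)" by simp
  show le: "ones d n \<le> r"
    using * by (metis dvd_triv_left power_dvd_imp_le one_less_numeral_iff semiring_norm(76))
  then have "2 ^ ones d n * card (K \<inter> column_space U) = 2 ^ ones d n * 2 ^ (r - ones d n)"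
    using * by (simp flip: power_add)
  then show KW: "card (K \<inter> column_space U) = 2 ^ (r - ones d n)" by simp
  have "card (K \<inter> column_space U) \<le> card K"
    by (intro card_mono) (auto simp: K_def finite_mat_kernel_bit)
  then show "r - ones d n \<le> n - r" unfolding KW cK by simp
qed

section \<open>The recurrences\<close>

lemma rank_count_triangular_factors:
  "rank_count d i t = card {U \<in> triangular_factors d i. int (vec_space.rank i U) = int (ones d i) + t}"
  unfolding rank_count_def triangular_factors_def by (auto intro!: arg_cong[of _ _ card])

lemma rank_excess_bounds:
  assumes d: "\<And>j. 1 \<le> j \<Longrightarrow> j \<le> n \<Longrightarrow> d j \<in> {0, 1}" and U: "U \<in> triangular_factors d n"
  shows "0 \<le> int (vec_space.rank n U) - int (ones d n)"
    and "int (vec_space.rank n U) - int (ones d n) \<le> zeros d n div 2"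
  using factor_counts[OF d U] unfolding zeros_def by linarith+

lemma rank_count_outside:
  assumes d: "\<And>j. 1 \<le> j \<Longrightarrow> j \<le> n \<Longrightarrow> d j \<in> {0, 1}" and t: "\<not> (0 \<le> t \<and> t \<le> zeros d n div 2)"
  shows "rank_count d n t = 0"
proof -
  have "{U \<in> triangular_factors d n. int (vec_space.rank n U) = int (ones d n) + t} = {}"
    using rank_excess_bounds[OF d] t by force
  then show ?thesis by (simp only: rank_count_triangular_factors card.empty)
qed

text \<open>Every one of the \<open>2\<^sup>n\<^sup>-\<^sup>r\<close> extensions of \<open>U\<close> raises the rank by one: if \<open>b\<close> lies in the column space,
  then \<open>b \<bullet> b = 0\<close> and the corner entry is \<open>1\<close>. The number of ones grows by one as well, so
  the excess \<open>t\<close> of the rank over the number of ones stays the same.\<close>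

lemma rank_count_Suc_one:
  assumes d: "\<And>j. 1 \<le> j \<Longrightarrow> j \<le> n \<Longrightarrow> d j \<in> {0, 1}" and one: "d (Suc n) = 1"
  shows "rank_count d (Suc n) t = 2 ^ nat (zeros d (Suc n) - t) * rank_count d n t"
proof -
  let ?P = "\<lambda>A. int (vec_space.rank (Suc n) A) = int (ones d (Suc n)) + t"
  have "card {b \<in> mat_kernel (transpose_mat U). ?P (border U b (of_nat (d (Suc n)) + b \<bullet> b))}
      = (if int (vec_space.rank n U) = int (ones d n) + t then 2 ^ nat (zeros d (Suc n) - t) else 0)"
    if U: "U \<in> triangular_factors d n" for U
  proof -
    let ?K = "mat_kernel (transpose_mat U)"
    have Uc: "U \<in> carrier_mat n n" using U by (simp add: triangular_factors_def)
    have "vec_space.rank (Suc n) (border U b (of_nat (d (Suc n)) + b \<bullet> b)) = Suc (vec_space.rank n U)"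
      if b: "b \<in> ?K" for b
    proof -
      have bc: "b \<in> carrier_vec n" using b Uc by (auto simp: mat_kernel[of _ n n])
      show ?thesis
        using rank_border[OF Uc bc] kernel_inter_column_space_isotropic[OF Uc b] one by auto
    qed
    then have "{b \<in> ?K. ?P (border U b (of_nat (d (Suc n)) + b \<bullet> b))}
        = (if int (vec_space.rank n U) = int (ones d n) + t then ?K else {})"
      using one by (auto simp: ones_Suc)
    moreover have "nat (zeros d (Suc n) - t) = n - vec_space.rank n U"
      if "int (vec_space.rank n U) = int (ones d n) + t"
      using that one factor_counts(2)[OF d U] by (simp add: zeros_def ones_Suc)
    ultimately show ?thesis using factor_counts(4)[OF d U] by simp
  qed
  then show ?thesis
    unfolding rank_count_triangular_factors[of d "Suc n"] card_triangular_factors_Suc_filter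
    by (simp add: sum.If_cases finite_triangular_factors rank_count_triangular_factors Int_def mult.commute)
qed

text \<open>The rank is unchanged for the \<open>2\<^sup>r\<^sup>-\<^sup>s\<close> vectors \<open>b\<close> of the kernel that lie in the column space, as
  then \<open>b \<bullet> b = 0\<close> and the corner entry is \<open>0\<close>; all other vectors of the kernel raise it by one. So the
  excess \<open>t\<close> arises from excess \<open>t\<close> by the former extensions, and from excess \<open>t - 1\<close> by the
  latter. For values of \<open>t\<close> outside the admissible range, where the truncated exponents are
  meaningless, the coefficients are multiplied by a count that vanishes.\<close>

lemma rank_count_Suc_zero:
  assumes d: "\<And>j. 1 \<le> j \<Longrightarrow> j \<le> n \<Longrightarrow> d j \<in> {0, 1}" and zero: "d (Suc n) = 0"
  shows "int (rank_count d (Suc n) t) = 2 ^ nat t * int (rank_count d n t)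
    + (2 ^ nat (zeros d (Suc n) - t) - 2 ^ nat (t - 1)) * int (rank_count d n (t - 1))"
proof -
  let ?P = "\<lambda>A. int (vec_space.rank (Suc n) A) = int (ones d (Suc n)) + t"
  let ?r = "\<lambda>U. int (vec_space.rank n U)"
  have "int (card {b \<in> mat_kernel (transpose_mat U). ?P (border U b (of_nat (d (Suc n)) + b \<bullet> b))})
      = (if ?r U = int (ones d n) + t then 2 ^ nat t else 0)
        + (if ?r U = int (ones d n) + (t - 1) then 2 ^ nat (zeros d (Suc n) - t) - 2 ^ nat (t - 1) else 0)"
    if U: "U \<in> triangular_factors d n" for U
  proof -
    let ?K = "mat_kernel (transpose_mat U)" and ?W = "column_space U"
    have Uc: "U \<in> carrier_mat n n" using U by (simp add: triangular_factors_def)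
    have "vec_space.rank (Suc n) (border U b (of_nat (d (Suc n)) + b \<bullet> b)) =
        (if b \<in> ?W then vec_space.rank n U else Suc (vec_space.rank n U))"
      if b: "b \<in> ?K" for b
    proof -
      have bc: "b \<in> carrier_vec n" using b Uc by (auto simp: mat_kernel[of _ n n])
      show ?thesis
        using rank_border[OF Uc bc] kernel_inter_column_space_isotropic[OF Uc b] zero by auto
    qed
    then have "{b \<in> ?K. ?P (border U b (of_nat (d (Suc n)) + b \<bullet> b))}
        = (if ?r U = int (ones d n) + t then ?K \<inter> ?W
           else if ?r U = int (ones d n) + (t - 1) then ?K - ?K \<inter> ?W else {})"
      using zero by (auto simp: ones_Suc split: if_splits)
    moreover have "int (card (?K - ?K \<inter> ?W))
        = 2 ^ (n - vec_space.rank n U) - 2 ^ (vec_space.rank n U - ones d n)"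
    proof -
      have "card (?K \<inter> ?W) \<le> card ?K" by (intro card_mono finite_mat_kernel_bit) auto
      moreover have "card (?K - ?K \<inter> ?W) = card ?K - card (?K \<inter> ?W)"
        by (intro card_Diff_subset finite_subset[OF _ finite_mat_kernel_bit]) auto
      ultimately show ?thesis
        using factor_counts(4,5)[OF d U] by (simp add: of_nat_diff)
    qed
    moreover have "nat t = vec_space.rank n U - ones d n" if "?r U = int (ones d n) + t"
      using that by simp
    moreover have "nat (zeros d (Suc n) - t) = n - vec_space.rank n U"
      and "nat (t - 1) = vec_space.rank n U - ones d n"
      if "?r U = int (ones d n) + (t - 1)"
      using that zero factor_counts(2)[OF d U] by (simp_all add: zeros_def ones_Suc)
    ultimately show ?thesis using factor_counts(5)[OF d U] by auto
  qed
  then show ?thesis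
    unfolding rank_count_triangular_factors[of d "Suc n"] card_triangular_factors_Suc_filter of_nat_sum
    by (simp add: sum.If_cases finite_triangular_factors rank_count_triangular_factors Int_def mult.commute sum.distrib)
qed

lemma factorization_count_eq_sum_rank_count:
  assumes d: "\<And>j. 1 \<le> j \<Longrightarrow> j \<le> n \<Longrightarrow> d j \<in> {0, 1}"
  shows "\<nu> (diag_prefix d n) = (\<Sum>t = 0..zeros d n div 2. rank_count d n t)"
proof -
  let ?e = "\<lambda>U. int (vec_space.rank n U) - int (ones d n)"
  have "\<nu> (diag_prefix d n) = card (triangular_factors d n)"
    using carrier_matD[OF diag_prefix_carrier[of d n]] by (simp add: factorization_count_def triangular_factors_def)
  also have "\<dots> = (\<Sum>t = 0..zeros d n div 2. card {U \<in> triangular_factors d n. ?e U = t})"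
    using sum.group[of "triangular_factors d n" "{0..zeros d n div 2}" ?e "\<lambda>_. 1 :: nat"]
      rank_excess_bounds[OF d] finite_triangular_factors by force
  also have "\<dots> = (\<Sum>t = 0..zeros d n div 2. rank_count d n t)"
    unfolding rank_count_triangular_factors by (intro sum.cong refl arg_cong[of _ _ card]) auto
  finally show ?thesis .
qed

theorem theorem4p5:
  fixes n :: nat and d :: "nat \<Rightarrow> nat"
  assumes d01: "\<And>j. 1 \<le> j \<Longrightarrow> j \<le> n \<Longrightarrow> d j \<in> {0, 1}"
  shows "(\<forall>i\<le>n. \<forall>t::int. \<not> (0 \<le> t \<and> t \<le> zeros d i div 2) \<longrightarrow> rank_count d i t = 0)
    \<and> (\<forall>i. 1 \<le> i \<and> i \<le> n \<and> d i = 1 \<longrightarrow>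
          (\<forall>t::int. 0 \<le> t \<and> t \<le> zeros d i div 2 \<longrightarrow>
             rank_count d i t = 2 ^ nat (zeros d i - t) * rank_count d (i - 1) t))
    \<and> (\<forall>i. 1 \<le> i \<and> i \<le> n \<and> d i = 0 \<longrightarrow>
          rank_count d i 0 = rank_count d (i - 1) 0 \<and>
          (\<forall>t::int. 1 \<le> t \<and> t \<le> zeros d i div 2 \<longrightarrow>
             int (rank_count d i t) =
               2 ^ nat t * int (rank_count d (i - 1) t)
               + (2 ^ nat (zeros d i - t) - 2 ^ nat (t - 1)) * int (rank_count d (i - 1) (t - 1))))
    \<and> \<nu> (diag_prefix d n) = (\<Sum>t = 0..zeros d n div 2. rank_count d n t)"
proof (intro conjI allI impI)
  have d: "d j \<in> {0, 1}" if "i \<le> n" "1 \<le> j" "j \<le> i" for i j using d01 that by simp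
  show "rank_count d i t = 0" if "i \<le> n" "\<not> (0 \<le> t \<and> t \<le> zeros d i div 2)" for i t
    using rank_count_outside[of i d t] d[OF that(1)] that(2) by blast
  show "rank_count d i t = 2 ^ nat (zeros d i - t) * rank_count d (i - 1) t"
    if "1 \<le> i \<and> i \<le> n \<and> d i = 1" for i t
  proof -
    from that obtain m where i: "i = Suc m" "m \<le> n" "d (Suc m) = 1" by (cases i) auto
    show ?thesis using rank_count_Suc_one[of m d t] d[OF i(2)] i by simp
  qed
  have rec0: "int (rank_count d i t) = 2 ^ nat t * int (rank_count d (i - 1) t)
      + (2 ^ nat (zeros d i - t) - 2 ^ nat (t - 1)) * int (rank_count d (i - 1) (t - 1))"
    if "1 \<le> i \<and> i \<le> n \<and> d i = 0" for i t
  proof -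
    from that obtain m where i: "i = Suc m" "m \<le> n" "d (Suc m) = 0" by (cases i) auto
    show ?thesis using rank_count_Suc_zero[of m d t] d[OF i(2)] i by simp
  qed
  then show "int (rank_count d i t) = 2 ^ nat t * int (rank_count d (i - 1) t)
      + (2 ^ nat (zeros d i - t) - 2 ^ nat (t - 1)) * int (rank_count d (i - 1) (t - 1))"
    if "1 \<le> i \<and> i \<le> n \<and> d i = 0" for i t using that by blast
  show "rank_count d i 0 = rank_count d (i - 1) 0" if i: "1 \<le> i \<and> i \<le> n \<and> d i = 0" for i
  proof -
    \<comment> \<open>At \<open>t = 0\<close> the second summand counts matrices of rank below the number of ones.\<close>
    have "i - 1 \<le> n" using i by linarith
    then have "rank_count d (i - 1) (- 1) = 0"
      using rank_count_outside[of "i - 1" d "- 1", OF d] by simp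
    then show ?thesis using rec0[OF i, of 0] by simp
  qed
  show "\<nu> (diag_prefix d n) = (\<Sum>t = 0..zeros d n div 2. rank_count d n t)"
    by (rule factorization_count_eq_sum_rank_count[OF d01])
qed

end
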